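(* Let $F\in\mathcal{F}'$ have square-integrable density $f$, let $f^*$ be its pdQ, and assume that $f^{2*}=(f^* )^*$ exists. Then $f^*$ is the density of the uniform distribution on $[0,1]$ (that is, $f^*=1$ almost everywhere on $(0,1)$) if and only if $f^{2*}$ is the density of the uniform distribution on $[0,1]$ (that is, $f^{2*}=1$ almost everywhere on $(0,1)$).
   Context: $\mathcal{F}'$ is the class of cumulative distribution functions $F$ on $\mathbb{R}$ that are absolutely continuous with respect to Lebesgue measure and whose density $f=F'$ is positive (almost everywhere on the support of $F$, and zero outside the support). For such $F$, the quantile function is $Q(u)=\inf\{x: F(x)\ge u\}$, $0<u<1$. If $\kappa_0=\int_{-\infty}^{\infty} f(x)^2\,dx<\infty$, the probability density quantile (pdQ) of $f$ is the probability density on $(0,1)$ given by $f^*(u)=f(Q(u))/\kappa_0$, $0<u<1$. Applying the same construction to $f^*$: with $\kappa_1=\int_0^1\{f^*(x)\}^2\,dx$ and $Q^*$ the quantile function of the distribution with density $f^*$, $f^{2*}(u)=f^*(Q^*(u))/\kappa_1$ for $0<u<1$; it exists if and only if $\kappa_1<\infty$. *)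

theory Defs
  imports "HOL-Probability.Probability"
begin

text \<open>A density is determined only up to null sets; \<open>has_pdf F f\<close> says that \<open>f\<close> is one of its
  Borel versions for the distribution function \<open>F\<close>.\<close>

definition has_pdf :: "(real \<Rightarrow> real) \<Rightarrow> (real \<Rightarrow> real) \<Rightarrow> bool" where
  "has_pdf F f \<longleftrightarrow> f \<in> borel_measurable borel \<and> (\<forall>x. 0 \<le> f x) \<and>
     prob_space (density lborel f) \<and> F = cdf (density lborel f)"

text \<open>The closed support of the distribution, expressed as the points of increase of \<open>F\<close>.\<close>

definition cdf_support :: "(real \<Rightarrow> real) \<Rightarrow> real set" where
  "cdf_support F = {x. \<forall>e>0. F (x - e) < F (x + e)}"

text \<open>The class \<open>\<F>'\<close>.\<close>

definition pos_density_cdfs :: "(real \<Rightarrow> real) set" where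
  "pos_density_cdfs = {F.
     (\<exists>M. real_distribution M \<and> absolutely_continuous lborel M \<and> F = cdf M) \<and>
     (\<exists>f. has_pdf F f \<and> (AE x in lborel. x \<in> cdf_support F \<longrightarrow> 0 < f x) \<and>
          (\<forall>x. x \<notin> cdf_support F \<longrightarrow> f x = 0))}"

text \<open>Only the values for \<open>0 < u < 1\<close> are meaningful.\<close>

definition quantile :: "(real \<Rightarrow> real) \<Rightarrow> real \<Rightarrow> real" where
  "quantile F u = Inf {x. u \<le> F x}"

definition kappa :: "(real \<Rightarrow> real) \<Rightarrow> real" where
  "kappa f = (LBINT x. (f x)\<^sup>2)"

text \<open>The probability density quantile of a density \<open>f\<close>. It is extended by \<open>0\<close> outside \<open>(0,1)\<close>, so
  that it is again a density on the real line: the construction can be iterated, and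
  \<open>kappa (pdQ f)\<close> is the integral of the square over \<open>(0,1)\<close>. It is meaningful only if
  \<open>f\<close> is square-integrable.\<close>

definition pdQ :: "(real \<Rightarrow> real) \<Rightarrow> real \<Rightarrow> real" where
  "pdQ f u = (if 0 < u \<and> u < 1 then f (quantile (cdf (density lborel f)) u) / kappa f else 0)"

end

theory Submission
  imports Defs
begin

text \<open>The quantile function of a distribution pushes the uniform distribution on \<open>(0,1)\<close> forward to
  that distribution. Hence \<open>pdQ g = 1\<close> almost everywhere on \<open>(0,1)\<close> exactly when \<open>g\<close> equals the
  constant \<open>kappa g\<close> almost everywhere on \<open>{g > 0}\<close>. For \<open>g = pdQ f\<close>, which is positive almost
  everywhere on \<open>(0,1)\<close> and has total mass 1, that constant can only be 1.\<close>

text \<open>Inverse transform sampling. \<open>quantile (cdf M)\<close> is literally the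
  pseudo-inverse \<open>I\<close> of the locale \<open>cdf_distribution\<close>, which carries both
  facts from the proof of Skorohod's theorem.\<close>

lemma distr_quantile:
  assumes "real_distribution M"
  shows "distr (restrict_space lborel {0<..<1}) borel (quantile (cdf M)) = M"
    and "quantile (cdf M) \<in> borel_measurable (restrict_space borel {0<..<1})"
proof -
  interpret cdf_distribution M
    using assms by (simp add: cdf_distribution_def)
  have quantile_eq: "quantile (cdf M) = I"
    by (simp add: quantile_def fun_eq_iff)
  show "distr (restrict_space lborel {0<..<1}) borel (quantile (cdf M)) = M"
    unfolding quantile_eq by (rule distr_I_eq_M)
  show "quantile (cdf M) \<in> borel_measurable (restrict_space borel {0<..<1})"
    unfolding quantile_eq by (rule measurable_CI)
qed

lemma quantile_measurable_lborel:
  assumes "real_distribution M"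
  shows "quantile (cdf M) \<in> restrict_space lborel {0<..<1} \<rightarrow>\<^sub>M borel"
  using distr_quantile(2)[OF assms]
  by (simp cong: measurable_cong_sets add: sets_restrict_space)

lemma AE_quantile_iff:
  assumes M: "real_distribution M" and P: "Measurable.pred borel P"
  shows "(AE u in lborel. 0 < u \<and> u < 1 \<longrightarrow> P (quantile (cdf M) u)) \<longleftrightarrow> (AE x in M. P x)"
proof -
  have "(AE x in M. P x)
      \<longleftrightarrow> (AE x in distr (restrict_space lborel {0<..<1}) borel (quantile (cdf M)). P x)"
    by (simp only: distr_quantile(1)[OF M])
  also have "\<dots> \<longleftrightarrow> (AE u in restrict_space lborel {0<..<1}. P (quantile (cdf M) u))"
    using P by (intro AE_distr_iff quantile_measurable_lborel[OF M]) (simp add: pred_def)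
  also have "\<dots> \<longleftrightarrow> (AE u in lborel. 0 < u \<and> u < 1 \<longrightarrow> P (quantile (cdf M) u))"
    by (simp add: AE_restrict_space_iff)
  finally show ?thesis ..
qed

lemma nn_integral_quantile:
  assumes M: "real_distribution M" and h: "h \<in> borel_measurable borel"
  shows "(\<integral>\<^sup>+u\<in>{0<..<1}. h (quantile (cdf M) u) \<partial>lborel) = (\<integral>\<^sup>+x. h x \<partial>M)"
proof -
  have "(\<integral>\<^sup>+x. h x \<partial>M)
      = (\<integral>\<^sup>+x. h x \<partial>distr (restrict_space lborel {0<..<1}) borel (quantile (cdf M)))"
    by (simp only: distr_quantile(1)[OF M])
  also have "\<dots> = (\<integral>\<^sup>+u. h (quantile (cdf M) u) \<partial>restrict_space lborel {0<..<1})"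
    using h by (intro nn_integral_distr quantile_measurable_lborel[OF M]) simp
  also have "\<dots> = (\<integral>\<^sup>+u\<in>{0<..<1}. h (quantile (cdf M) u) \<partial>lborel)"
    by (intro nn_integral_restrict_space) simp
  finally show ?thesis ..
qed

lemma real_distribution_density:
  assumes "has_pdf F f"
  shows "real_distribution (density lborel f)"
  using assms by (auto simp: has_pdf_def real_distribution_def real_distribution_axioms_def)

lemma has_pdf_nn_integral:
  assumes "has_pdf F f"
  shows "(\<integral>\<^sup>+x. f x \<partial>lborel) = 1"
proof -
  interpret prob_space "density lborel f"
    using assms by (simp add: has_pdf_def)
  show ?thesis
    using emeasure_space_1 assms by (simp add: emeasure_density has_pdf_def)
qed

text \<open>A vanishing integral of the square would force \<open>f\<close> to be 0 almost
  everywhere, against total mass 1. Integrability matters here, since the Bochner integral defaults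
  to 0 without it.\<close>

lemma kappa_pos:
  assumes pdf: "has_pdf F f" and int: "integrable lborel (\<lambda>x. (f x)\<^sup>2)"
  shows "0 < kappa f"
proof -
  have "kappa f \<noteq> 0"
  proof
    assume "kappa f = 0"
    then have "AE x in lborel. (f x)\<^sup>2 = 0"
      using integral_nonneg_eq_0_iff_AE[OF int] by (simp add: kappa_def)
    then have "(\<integral>\<^sup>+x. f x \<partial>lborel) = (\<integral>\<^sup>+x. 0 \<partial>(lborel :: real measure))"
      by (intro nn_integral_cong_AE) auto
    then show False
      using has_pdf_nn_integral[OF pdf] by simp
  qed
  moreover have "0 \<le> kappa f"
    by (simp add: kappa_def)
  ultimately show ?thesis by simp
qed

text \<open>Under the uniform law on (0,1), \<open>pdQ f\<close> is distributed as
  \<open>f x / kappa f\<close> with \<open>x\<close> drawn from the density \<open>f\<close>; the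
  null sets of that law are those that are Lebesgue-null within \<open>{f > 0}\<close>.\<close>

lemma AE_pdQ_iff:
  assumes pdf: "has_pdf F f" and P: "Measurable.pred borel P"
  shows "(AE u in lborel. 0 < u \<and> u < 1 \<longrightarrow> P (pdQ f u))
     \<longleftrightarrow> (AE x in lborel. 0 < f x \<longrightarrow> P (f x / kappa f))"
proof -
  have f [measurable]: "f \<in> borel_measurable borel"
    using pdf by (simp add: has_pdf_def)
  note P [measurable]
  have "(AE u in lborel. 0 < u \<and> u < 1 \<longrightarrow> P (pdQ f u)) \<longleftrightarrow>
        (AE u in lborel. 0 < u \<and> u < 1 \<longrightarrow> P (f (quantile (cdf (density lborel f)) u) / kappa f))"
    by (intro AE_cong) (auto simp: pdQ_def)
  also have "\<dots> \<longleftrightarrow> (AE x in density lborel f. P (f x / kappa f))"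
    by (intro AE_quantile_iff real_distribution_density[OF pdf]) measurable
  also have "\<dots> \<longleftrightarrow> (AE x in lborel. 0 < f x \<longrightarrow> P (f x / kappa f))"
    by (simp add: AE_density)
  finally show ?thesis .
qed

lemma pdQ_measurable:
  assumes pdf: "has_pdf F f"
  shows "pdQ f \<in> borel_measurable borel"
proof -
  have f [measurable]: "f \<in> borel_measurable borel"
    using pdf by (simp add: has_pdf_def)
  note distr_quantile(2)[OF real_distribution_density[OF pdf], measurable]
  have "(\<lambda>u. f (quantile (cdf (density lborel f)) u) / kappa f)
      \<in> borel_measurable (restrict_space borel {0<..<1})"
    by measurable
  then have "(\<lambda>u. if u \<in> {0<..<1} then f (quantile (cdf (density lborel f)) u) / kappa f else 0)
      \<in> borel_measurable borel"
    by (subst (asm) measurable_restrict_space_iff[where c = 0]) auto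
  then show ?thesis
    by (simp add: pdQ_def[abs_def])
qed

text \<open>Pulled back along the quantile function, the total mass becomes the integral of
  \<open>f / kappa f\<close> against \<open>f\<close>, that is \<open>kappa f / kappa f\<close>.
  This makes every lemma about \<open>f\<close> applicable to \<open>pdQ f\<close> as well.\<close>

lemma has_pdf_pdQ:
  assumes pdf: "has_pdf F f" and int: "integrable lborel (\<lambda>x. (f x)\<^sup>2)"
  shows "has_pdf (cdf (density lborel (pdQ f))) (pdQ f)"
proof -
  have f [measurable]: "f \<in> borel_measurable borel" and f_nonneg: "0 \<le> f x" for x
    using pdf by (auto simp: has_pdf_def)
  note kappa = kappa_pos[OF pdf int]
  have "(\<integral>\<^sup>+u. pdQ f u \<partial>lborel)
      = (\<integral>\<^sup>+u\<in>{0<..<1}. ennreal (f (quantile (cdf (density lborel f)) u) / kappa f) \<partial>lborel)"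
    by (intro nn_integral_cong) (auto simp: pdQ_def indicator_def)
  also have "\<dots> = (\<integral>\<^sup>+x. ennreal (f x / kappa f) \<partial>density lborel f)"
    by (intro nn_integral_quantile real_distribution_density[OF pdf]) measurable
  also have "\<dots> = (\<integral>\<^sup>+x. ennreal ((f x)\<^sup>2 / kappa f) \<partial>lborel)"
    using kappa f_nonneg
    by (subst nn_integral_density)
       (auto intro!: nn_integral_cong simp: ennreal_mult[symmetric] power2_eq_square)
  also have "\<dots> = ennreal (LBINT x. (f x)\<^sup>2 / kappa f)"
    using kappa int by (intro nn_integral_eq_integral) auto
  also have "\<dots> = 1"
    using kappa by (simp add: kappa_def)
  finally have "prob_space (density lborel (pdQ f))"
    using pdQ_measurable[OF pdf] by (intro prob_spaceI) (simp add: emeasure_density)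
  moreover have "0 \<le> pdQ f u" for u
    using kappa f_nonneg by (simp add: pdQ_def)
  ultimately show ?thesis
    using pdQ_measurable[OF pdf] by (simp add: has_pdf_def)
qed

text \<open>A point drawn from the density \<open>f\<close> almost surely lies where
  \<open>f\<close> is positive, so the quantile function maps almost every \<open>u\<close> in (0,1)
  there.\<close>

lemma pdQ_pos_AE:
  assumes pdf: "has_pdf F f" and int: "integrable lborel (\<lambda>x. (f x)\<^sup>2)"
  shows "AE u in lborel. 0 < u \<and> u < 1 \<longrightarrow> 0 < pdQ f u"
  using kappa_pos[OF pdf int] by (subst AE_pdQ_iff[OF pdf]) auto

lemma pdf_const_unit_interval:
  assumes pdf: "has_pdf G g" and const: "AE u in lborel. g u = c * indicator {0<..<1} u"
  shows "c = 1" and "kappa g = 1"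
proof -
  have "1 = (\<integral>\<^sup>+u. g u \<partial>lborel)"
    using has_pdf_nn_integral[OF pdf] by simp
  also have "\<dots> = (\<integral>\<^sup>+u. ennreal c * indicator {0<..<1} u \<partial>(lborel :: real measure))"
    using const by (intro nn_integral_cong_AE) (auto simp: indicator_def)
  \<comment> \<open>The interval has length 1. A negative \<open>c\<close> would be truncated to 0
    by \<open>ennreal\<close>, so \<open>ennreal c = 1\<close> does determine
    \<open>c\<close>.\<close>
  also have "\<dots> = ennreal c"
    by (simp add: nn_integral_cmult_indicator)
  finally show c: "c = 1"
    by (metis ennreal_eq_1)
  have [measurable]: "g \<in> borel_measurable borel"
    using pdf by (simp add: has_pdf_def)
  have "kappa g = (LBINT u. indicator {0<..<1} (u :: real))"
    unfolding kappa_def using const c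
    by (intro integral_cong_AE) (auto simp: indicator_def)
  then show "kappa g = 1"
    by simp
qed

theorem proposition2p3:
  fixes F f :: "real \<Rightarrow> real"
  assumes "F \<in> pos_density_cdfs"
    and "has_pdf F f"
    and "integrable lborel (\<lambda>x. (f x)\<^sup>2)"
    and "integrable lborel (\<lambda>u. (pdQ f u)\<^sup>2)"
  shows "(AE u in lborel. 0 < u \<and> u < 1 \<longrightarrow> pdQ f u = 1) \<longleftrightarrow>
         (AE u in lborel. 0 < u \<and> u < 1 \<longrightarrow> pdQ (pdQ f) u = 1)"
proof -
  define g where "g = pdQ f"
  have pdf: "has_pdf (cdf (density lborel g)) g"
    unfolding g_def using assms(2,3) by (rule has_pdf_pdQ)
  have kappa: "0 < kappa g"
    using pdf assms(4) unfolding g_def by (rule kappa_pos)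
  have g_pos: "AE u in lborel. 0 < u \<and> u < 1 \<longrightarrow> 0 < g u"
    unfolding g_def using assms(2,3) by (rule pdQ_pos_AE)
  have g_zero: "g u = 0" if "\<not> (0 < u \<and> u < 1)" for u
    using that by (simp only: g_def pdQ_def if_False)
  have "(AE u in lborel. 0 < u \<and> u < 1 \<longrightarrow> pdQ g u = 1)
      \<longleftrightarrow> (AE u in lborel. 0 < g u \<longrightarrow> g u / kappa g = 1)"
    by (rule AE_pdQ_iff[OF pdf]) measurable
  \<comment> \<open>By \<open>g_pos\<close> and \<open>g_zero\<close>, the set
    \<open>{g > 0}\<close> is (0,1) up to a null set.\<close>
  also have "\<dots> \<longleftrightarrow> (AE u in lborel. g u = kappa g * indicator {0<..<1} u)"
  proof
    assume "AE u in lborel. 0 < g u \<longrightarrow> g u / kappa g = 1"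
    with g_pos show "AE u in lborel. g u = kappa g * indicator {0<..<1} u"
      by eventually_elim (use g_zero in \<open>auto simp: indicator_def\<close>)
  next
    assume "AE u in lborel. g u = kappa g * indicator {0<..<1} u"
    then show "AE u in lborel. 0 < g u \<longrightarrow> g u / kappa g = 1"
      by eventually_elim (use kappa in \<open>auto simp: indicator_def\<close>)
  qed
  \<comment> \<open>Either side yields \<open>kappa g = 1\<close>: the left one by the first part of
    \<open>pdf_const_unit_interval\<close> with \<open>c = kappa g\<close>, the right one by the
    second part with \<open>c = 1\<close>.\<close>
  also have "\<dots> \<longleftrightarrow> (AE u in lborel. g u = 1 * indicator {0<..<1} u)"
    using pdf_const_unit_interval[OF pdf] by metis
  also have "\<dots> \<longleftrightarrow> (AE u in lborel. 0 < u \<and> u < 1 \<longrightarrow> g u = 1)"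
    by (intro AE_cong) (use g_zero in \<open>auto simp: indicator_def\<close>)
  finally show ?thesis
    by (simp add: g_def)
qed

end
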